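(* Let $B=5$, let $\tilde p<0$ be an integer and $\tilde q$ a positive integer with $\tilde q\geqslant 3600\sqrt[3]{|\tilde p|}$ and $2\tilde q>|\tilde p|$. Let $F_2=B^{2}\tilde q^{6}-2B\tilde q^{4}-2B\tilde p\tilde q^{3}-2\tilde q^{2}+2\tilde p\tilde q+\tilde p^{2}-\frac5B-\frac{20}{B^{2}\tilde q^{2}}$. Then there is no integer $t$ with $F_2<t<F_2-\frac{10\tilde p}{B^{2}\tilde q^{3}}$. *)

theory Defs
  imports Complex_Main
begin

definition F2 :: "real \<Rightarrow> real \<Rightarrow> real \<Rightarrow> real" where
  "F2 B p q = B^2 * q^6 - 2 * B * q^4 - 2 * B * p * q^3 - 2 * q^2 + 2 * p * q + p^2
     - 5 / B - 20 / (B^2 * q^2)"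

end

theory Submission
  imports Defs
begin

text \<open>When \<open>B\<close> divides 5, all terms of \<open>F\<^sub>2\<close> but the last are integers, so \<open>F\<^sub>2 = N - 20 / (B\<^sup>2 q\<^sup>2)\<close>
  with \<open>N\<close> an integer. Since \<open>-p < 2 q\<close>, the length \<open>-10 p / (B\<^sup>2 q\<^sup>3)\<close> of the interval is less than
  \<open>20 / (B\<^sup>2 q\<^sup>2)\<close>; if the latter is at most 1, the open interval is contained
  in \<open>(N - 1, N)\<close>.\<close>

lemma F2_plus_last_term_in_Ints:
  fixes b p q :: int
  assumes "b dvd 5"
  shows "F2 b p q + 20 / (b\<^sup>2 * q\<^sup>2) \<in> \<int>"
proof -
  have "5 / real_of_int b \<in> \<int>"
    using of_int_divide_in_Ints[OF assms, where 'a = real] by simp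
  then show ?thesis
    by (simp add: F2_def)
qed

lemma F2_interval_length_less:
  fixes B p q :: real
  assumes "B \<noteq> 0" "q > 0" "- p < 2 * q"
  shows "- (10 * p / (B\<^sup>2 * q^3)) < 20 / (B\<^sup>2 * q\<^sup>2)"
proof -
  have "- (10 * p / (B\<^sup>2 * q^3)) = 10 * (- p) / (B\<^sup>2 * q^3)"
    by simp
  also have "\<dots> < 10 * (2 * q) / (B\<^sup>2 * q^3)"
    using assms by (intro divide_strict_right_mono) auto
  also have "\<dots> = 20 / (B\<^sup>2 * q\<^sup>2)"
    using \<open>q > 0\<close> by (simp add: power2_eq_square power3_eq_cube)
  finally show ?thesis .
qed

lemma no_int_in_F2_interval:
  fixes b p q t :: int
  assumes "b dvd 5" "q > 0" "- p < 2 * q" "20 \<le> b\<^sup>2 * q\<^sup>2"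
  shows "\<not> (F2 b p q < t \<and> t < F2 b p q - 10 * p / (b\<^sup>2 * q^3))"
proof
  assume t: "F2 b p q < t \<and> t < F2 b p q - 10 * p / (b\<^sup>2 * q^3)"
  obtain N :: int where N: "F2 b p q + 20 / (b\<^sup>2 * q\<^sup>2) = N"
    using F2_plus_last_term_in_Ints[OF \<open>b dvd 5\<close>] by (metis Ints_cases)
  have "real_of_int 20 \<le> real_of_int (b\<^sup>2 * q\<^sup>2)"
    using \<open>20 \<le> b\<^sup>2 * q\<^sup>2\<close> by (simp only: of_int_le_iff)
  then have "20 / (b\<^sup>2 * q\<^sup>2) \<le> (1 :: real)"
    by (simp add: divide_le_eq_1)
  with t N have "N - 1 < t"
    by linarith
  have "real_of_int b \<noteq> 0" "real_of_int q > 0" "- real_of_int p < 2 * real_of_int q"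
    using assms by auto
  then have "- (10 * p / (b\<^sup>2 * q^3)) < (20 / (b\<^sup>2 * q\<^sup>2) :: real)"
    using F2_interval_length_less by simp
  with t N have "t < N"
    by linarith
  with \<open>N - 1 < t\<close> show False
    by linarith
qed

theorem theorem7p7:
  fixes B :: real and p q :: int
  assumes "B = 5"
    and "p < 0"
    and "q > 0"
    and "real_of_int q \<ge> 3600 * root 3 \<bar>real_of_int p\<bar>"
    and "2 * q > \<bar>p\<bar>"
  shows "\<not> (\<exists>t::int. F2 B (real_of_int p) (real_of_int q) < real_of_int t \<and>
           real_of_int t < F2 B (real_of_int p) (real_of_int q)
             - 10 * real_of_int p / (B^2 * (real_of_int q)^3))"
proof -
  have "- p < 2 * q"
    using \<open>2 * q > \<bar>p\<bar>\<close> by linarith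
  moreover have "1 \<le> q\<^sup>2"
    using \<open>q > 0\<close> by simp
  then have "20 \<le> 5\<^sup>2 * q\<^sup>2"
    by simp
  ultimately show ?thesis
    using no_int_in_F2_interval[of 5 q p] \<open>q > 0\<close> \<open>B = 5\<close> by simp
qed

end
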